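(* Fix an integer $k\ge 2$. Let $\xi(m,r,s,u)$ be the formal power series in $r$ satisfying $$f(rs)\,\xi(m,r,s,u)=1+rs(m-1)\prod_{j=0}^{k-1}\xi(m,rs^{j},s,u)-mrsu\prod_{j=0}^{k}\xi(m,rs^{j},s,u),$$ where $f(x)=1+x(m-1)$. Then $$\xi(m,r,s,u)=\sum_{n\ge 0}(-rs)^{n}\sum_{\mu\in\mathtt{Dyck}(n;k)}s^{|Y(\mu_{0}/\mu)|}\,\mathrm{wt}^{II}(k;\mu).$$
   Context: $m,s,u$ are formal variables, $m'=m-1$, $u'=u-1$, and power series in $r$ have coefficients in $\mathbb{Z}[m,s,u]$. A $k$-Dyck path of size $n$ is a lattice path from $(0,0)$ to $(kn,n)$ consisting of up steps $U=(0,1)$ and down steps $D=(1,0)$ which never goes below the line $y=x/k$; $\mathtt{Dyck}(n;k)$ is the set of them. $\mu_0=(UD^k)^n$ is the lowest path, and $|Y(\mu_0/\mu)|$ is the number of unit boxes above $\mu_0$ and below $\mu$. A valley of $\mu$ is an occurrence of the pattern $DU$; the size $|v|$ of a valley $v$ is the maximal $p$ such that $\mu$ has the pattern $D^{p}U$ (consecutive steps) at $v$. $\mathrm{Val}^{II}(k;\mu)$ is the number of valleys $v$ of $\mu$ with $0<|v|\le k-1$. For $\mu\in\mathtt{Dyck}(n;k)$, $$\mathrm{wt}^{II}(k;\mu)=(m'+1)^{n-\mathrm{Val}^{II}(k;\mu)}(u'+1)^{n-\mathrm{Val}^{II}(k;\mu)}(m'u'+u'+1)^{\mathrm{Val}^{II}(k;\mu)}.$$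 *)

theory Defs
  imports "HOL-Computational_Algebra.Computational_Algebra"
begin

(* Z[m,s,u] is realised as the iterated polynomial ring Z[m][s][u]. *)
type_synonym zmsu = "int poly poly poly"

definition m_var :: zmsu where "m_var = [:[:[:0, 1:]:]:]"
definition s_var :: zmsu where "s_var = [:[:0, 1:]:]"
definition u_var :: zmsu where "u_var = [:0, 1:]"

(* Up is the step (0,1), Down is the step (1,0); a path starts at (0,0). *)
datatype step = Up | Down

type_synonym path = "step list"

definition xpos :: "path \<Rightarrow> nat \<Rightarrow> nat" where
  "xpos w i = count_list (take i w) Down"

definition ypos :: "path \<Rightarrow> nat \<Rightarrow> nat" where
  "ypos w i = count_list (take i w) Up"

(* The condition y \<ge> x/k is imposed on the lattice points of the path only; since the
   region is convex, the unit steps between them satisfy it as well. *)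
definition Dyck :: "nat \<Rightarrow> nat \<Rightarrow> path set" where
  "Dyck n k = {w. xpos w (length w) = k * n \<and> ypos w (length w) = n \<and>
                  (\<forall>i\<le>length w. real (ypos w i) \<ge> real (xpos w i) / real k)}"

definition mu0 :: "nat \<Rightarrow> nat \<Rightarrow> path" where
  "mu0 n k = concat (replicate n (Up # replicate k Down))"

(* (i,j) stands for the unit box [i,i+1] x [j,j+1]. It is compared with the horizontal
   step of the path from x = i to x = i+1. *)
definition box_below :: "path \<Rightarrow> nat \<times> nat \<Rightarrow> bool" where
  "box_below w = (\<lambda>(i, j). \<exists>p<length w. w ! p = Down \<and> xpos w p = i \<and> j + 1 \<le> ypos w p)"

definition box_above :: "path \<Rightarrow> nat \<times> nat \<Rightarrow> bool" where
  "box_above w = (\<lambda>(i, j). \<exists>p<length w. w ! p = Down \<and> xpos w p = i \<and> ypos w p \<le> j)"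

definition boxes_between :: "path \<Rightarrow> path \<Rightarrow> (nat \<times> nat) set" where
  "boxes_between lower upper = {b. box_above lower b \<and> box_below upper b}"

(* A valley is recorded by the index of the Up step of its pattern Down Up. *)
definition valleys :: "path \<Rightarrow> nat set" where
  "valleys w = {v. \<exists>xs ys. w = xs @ [Down, Up] @ ys \<and> v = length xs + 1}"

definition valley_size :: "path \<Rightarrow> nat \<Rightarrow> nat" where
  "valley_size w v =
     Max {p. \<exists>xs ys. w = xs @ replicate p Down @ [Up] @ ys \<and> v = length xs + p}"

definition ValII :: "nat \<Rightarrow> path \<Rightarrow> nat" where
  "ValII k w = card {v \<in> valleys w. 0 < valley_size w v \<and> valley_size w v \<le> k - 1}"

(* The argument n is the size of the path w. The exponent n - ValII k w involves no
   truncation: each valley uses a distinct Up step of w. *)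
definition wtII :: "nat \<Rightarrow> nat \<Rightarrow> path \<Rightarrow> zmsu" where
  "wtII k n w =
     (let m' = m_var - 1; u' = u_var - 1 in
      (m' + 1) ^ (n - ValII k w) * (u' + 1) ^ (n - ValII k w) * (m' * u' + u' + 1) ^ ValII k w)"

definition r_var :: "zmsu fps" where "r_var = fps_X"

(* xi(m, r s^j, s, u): the variable r is replaced by r s^j; all others are unchanged. *)
definition r_shift :: "nat \<Rightarrow> zmsu fps \<Rightarrow> zmsu fps" where
  "r_shift j \<xi> = \<xi> oo (r_var * fps_const (s_var ^ j))"

definition f_series :: "zmsu fps \<Rightarrow> zmsu fps" where
  "f_series x = 1 + x * fps_const (m_var - 1)"

definition functional_equation :: "nat \<Rightarrow> zmsu fps \<Rightarrow> bool" where
  "functional_equation k \<xi> \<longleftrightarrow>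
     f_series (r_var * fps_const s_var) * \<xi> =
       1 + r_var * fps_const s_var * fps_const (m_var - 1) * (\<Prod>j=0..k-1. r_shift j \<xi>)
         - fps_const m_var * r_var * fps_const s_var * fps_const u_var * (\<Prod>j=0..k. r_shift j \<xi>)"

end

theory Submission
  imports Defs
begin

text \<open>Read a path from left to right and keep as state the height \<open>h = k y - x\<close> and the
length \<open>p\<close> of the current run of down steps. The area is the sum of the heights at which the up
steps start, and an up step ends a valley counted by \<^const>\<open>ValII\<close> iff \<open>0 < p < k\<close>; hence the
generating series of the completions of a path in state \<open>(h, p)\<close> satisfy a linear recursion in
the first step, which determines them. Writing \<open>R\<^sub>h\<close> for the product of the \<open>h\<close> first
shifts of \<open>\<xi>\<close>, the functional equation, shifted and multiplied by \<open>R\<^sub>h\<close>, says exactly that an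
explicit linear combination of such products satisfies the same recursion, up to the factor
\<open>m u\<close>, which is cancelled in the state \<open>(0, 0)\<close>.\<close>

section \<open>Scanning statistics of paths and their first-step structure\<close>

text \<open>A column of a path starting at \<open>(x, y)\<close> is recorded by its left end and its height.\<close>

fun columns :: "nat \<Rightarrow> nat \<Rightarrow> path \<Rightarrow> (nat \<times> nat) set" where
  "columns x y [] = {}"
| "columns x y (Up # w) = columns x (Suc y) w"
| "columns x y (Down # w) = insert (x, y) (columns (Suc x) y w)"

text \<open>Here \<open>h\<close> stands for \<open>k * y - x\<close>. An up step from
  \<open>(x, y)\<close> opens row \<open>y\<close>, in which exactly the \<open>h\<close> boxes
  between \<open>x\<close> and \<open>k * y\<close> lie below the path and above
  \<open>mu0\<close>.\<close>

fun area :: "nat \<Rightarrow> nat \<Rightarrow> path \<Rightarrow> nat" where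
  "area k h [] = 0"
| "area k h (Up # w) = h + area k (h + k) w"
| "area k h (Down # w) = area k (h - 1) w"

fun small_valleys :: "nat \<Rightarrow> nat \<Rightarrow> path \<Rightarrow> nat" where
  "small_valleys k p [] = 0"
| "small_valleys k p (Up # w) = (if 0 < p \<and> p < k then 1 else 0) + small_valleys k 0 w"
| "small_valleys k p (Down # w) = small_valleys k (Suc p) w"

text \<open>The completions of a path at height \<open>h\<close> that has \<open>n\<close> up steps
  left; the number of down steps forces the end onto the boundary line.\<close>

definition suffixes :: "nat \<Rightarrow> nat \<Rightarrow> nat \<Rightarrow> path set" where
  "suffixes k n h = {w. count_list w Up = n \<and> count_list w Down = h + k * n \<and>
     (\<forall>i\<le>length w. xpos w i \<le> h + k * ypos w i)}"

lemma pos_0 [simp]: "xpos w 0 = 0" "ypos w 0 = 0"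
  and pos_Up [simp]: "xpos (Up # w) (Suc i) = xpos w i" "ypos (Up # w) (Suc i) = Suc (ypos w i)"
  and pos_Down [simp]: "xpos (Down # w) (Suc i) = Suc (xpos w i)" "ypos (Down # w) (Suc i) = ypos w i"
  by (simp_all add: xpos_def ypos_def)

lemma All_le_Suc: "(\<forall>i\<le>Suc n. P i) \<longleftrightarrow> P 0 \<and> (\<forall>i\<le>n. P (Suc i))"
  by (metis Suc_le_mono not0_implies_Suc zero_le)

lemma Nil_in_suffixes [simp]: "[] \<in> suffixes k n h \<longleftrightarrow> n = 0 \<and> h = 0"
  by (auto simp: suffixes_def)

lemma Up_in_suffixes [simp]:
  "Up # w \<in> suffixes k n h \<longleftrightarrow> 0 < n \<and> w \<in> suffixes k (n - 1) (h + k)"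
  by (cases n) (auto simp: suffixes_def All_le_Suc algebra_simps)

lemma Down_in_suffixes [simp]:
  "Down # w \<in> suffixes k n h \<longleftrightarrow> 0 < h \<and> w \<in> suffixes k n (h - 1)"
  by (cases h) (auto simp: suffixes_def All_le_Suc)

lemma finite_suffixes: "finite (suffixes k n h)"
proof -
  have "length w = count_list w Up + count_list w Down" for w :: path
  proof (induction w)
    case (Cons x w)
    then show ?case by (cases x) auto
  qed auto
  then have "suffixes k n h \<subseteq> {w. set w \<subseteq> {Up, Down} \<and> length w = n + (h + k * n)}"
    by (auto simp: suffixes_def) (metis step.exhaust)
  then show ?thesis
    by (rule finite_subset) (simp add: finite_lists_length_eq)
qed

lemma suffixes_rec:
  "suffixes k n h = (if n = 0 \<and> h = 0 then {[]} else {}) \<union>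
     (if 0 < n then (#) Up ` suffixes k (n - 1) (h + k) else {}) \<union>
     (if 0 < h then (#) Down ` suffixes k n (h - 1) else {})"
proof (intro set_eqI)
  fix w
  show "w \<in> suffixes k n h \<longleftrightarrow> w \<in> (if n = 0 \<and> h = 0 then {[]} else {}) \<union>
     (if 0 < n then (#) Up ` suffixes k (n - 1) (h + k) else {}) \<union>
     (if 0 < h then (#) Down ` suffixes k n (h - 1) else {})"
  proof (cases w)
    case (Cons x v)
    then show ?thesis by (cases x) auto
  qed auto
qed

lemma Dyck_eq_suffixes:
  assumes "0 < k"
  shows "Dyck n k = suffixes k n 0"
proof -
  have "real x / real k \<le> real y \<longleftrightarrow> x \<le> k * y" for x y
  proof -
    have "real x / real k \<le> real y \<longleftrightarrow> real x \<le> real (k * y)"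
      using assms by (simp add: field_simps)
    then show ?thesis by (simp only: of_nat_le_iff)
  qed
  then show ?thesis
    by (auto simp: Dyck_def suffixes_def xpos_def ypos_def)
qed

section \<open>Area: from columns of boxes to rows\<close>

lemma columns_eq:
  "columns x y w = {(x + xpos w p, y + ypos w p) |p. p < length w \<and> w ! p = Down}"
proof (induction x y w rule: columns.induct)
  case (2 x y w)
  have "{(x + xpos (Up # w) p, y + ypos (Up # w) p) |p. p < length (Up # w) \<and> (Up # w) ! p = Down}
      = {(x + xpos w p, Suc y + ypos w p) |p. p < length w \<and> w ! p = Down}" (is "?L = ?R")
  proof (intro equalityI subsetI)
    fix z assume "z \<in> ?L"
    then obtain p where p: "z = (x + xpos (Up # w) p, y + ypos (Up # w) p)"
      "p < length (Up # w)" "(Up # w) ! p = Down" by blast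
    then obtain q where "p = Suc q" by (cases p) auto
    with p show "z \<in> ?R" by auto
  next
    fix z assume "z \<in> ?R"
    then obtain p where "z = (x + xpos w p, Suc y + ypos w p)" "p < length w" "w ! p = Down"
      by blast
    then show "z \<in> ?L" by (intro CollectI exI[of _ "Suc p"]) auto
  qed
  with 2 show ?case by simp
next
  case (3 x y w)
  have "{(x + xpos (Down # w) p, y + ypos (Down # w) p) |p. p < length (Down # w) \<and> (Down # w) ! p = Down}
      = insert (x, y) {(Suc x + xpos w p, y + ypos w p) |p. p < length w \<and> w ! p = Down}" (is "?L = ?R")
  proof (intro equalityI subsetI)
    fix z assume "z \<in> ?L"
    then obtain p where p: "z = (x + xpos (Down # w) p, y + ypos (Down # w) p)"
      "p < length (Down # w)" "(Down # w) ! p = Down" by blast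
    then show "z \<in> ?R" by (cases p) auto
  next
    fix z assume "z \<in> ?R"
    then consider "z = (x, y)"
      | p where "z = (Suc x + xpos w p, y + ypos w p)" "p < length w" "w ! p = Down"
      by blast
    then show "z \<in> ?L"
    proof cases
      case 1
      then show ?thesis by (intro CollectI exI[of _ 0]) auto
    next
      case 2
      then show ?thesis by (intro CollectI exI[of _ "Suc p"]) auto
    qed
  qed
  with 3 show ?case by simp
qed auto

lemma box_below_iff: "box_below w (i, j) \<longleftrightarrow> (\<exists>y. (i, y) \<in> columns 0 0 w \<and> j < y)"
  by (auto simp: box_below_def columns_eq less_eq_Suc_le)

lemma box_above_iff: "box_above w (i, j) \<longleftrightarrow> (\<exists>y. (i, y) \<in> columns 0 0 w \<and> y \<le> j)"
  by (auto simp: box_above_def columns_eq)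

lemma columns_replicate_Down:
  "columns x y (replicate c Down @ w) = (\<lambda>i. (i, y)) ` {x..<x + c} \<union> columns (x + c) y w"
proof (induction c arbitrary: x)
  case (Suc c)
  have "{x..<x + Suc c} = insert x {Suc x..<Suc x + c}" by auto
  with Suc show ?case by auto
qed auto

text \<open>Starting at an arbitrary corner \<open>(k * y, y)\<close> lets the induction peel off
  one block \<open>Up # replicate k Down\<close> at a time.\<close>

lemma columns_mu0:
  assumes "0 < k"
  shows "columns (k * y) y (mu0 n k) = {(i, Suc (i div k)) |i. k * y \<le> i \<and> i < k * (y + n)}"
proof (induction n arbitrary: y)
  case (Suc n)
  have "mu0 (Suc n) k = Up # replicate k Down @ mu0 n k"
    by (simp add: mu0_def)
  then have "columns (k * y) y (mu0 (Suc n) k) =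
      (\<lambda>i. (i, Suc y)) ` {k * y..<k * y + k} \<union> columns (k * y + k) (Suc y) (mu0 n k)"
    by (simp add: columns_replicate_Down)
  also have "columns (k * y + k) (Suc y) (mu0 n k) =
      {(i, Suc (i div k)) |i. k * Suc y \<le> i \<and> i < k * (Suc y + n)}"
    using Suc[of "Suc y"] by (simp add: add.commute)
  also have "(\<lambda>i. (i, Suc y)) ` {k * y..<k * y + k} =
      {(i, Suc (i div k)) |i. k * y \<le> i \<and> i < k * Suc y}"
  proof -
    have "i div k = y" if "k * y \<le> i" "i < k * Suc y" for i
      using that assms by (intro div_nat_eqI) (auto simp: mult.commute)
    then show ?thesis by (force simp: image_iff)
  qed
  also have "\<dots> \<union> {(i, Suc (i div k)) |i. k * Suc y \<le> i \<and> i < k * (Suc y + n)} =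
      {(i, Suc (i div k)) |i. k * y \<le> i \<and> i < k * (y + Suc n)}"
  proof -
    have "k * y \<le> k * Suc y" "k * Suc y \<le> k * (y + Suc n)" by (simp_all del: mult_Suc_right)
    then have "k * y \<le> i \<and> i < k * Suc y \<or> k * Suc y \<le> i \<and> i < k * (Suc y + n) \<longleftrightarrow>
        k * y \<le> i \<and> i < k * (y + Suc n)" for i
      by (metis add_Suc_shift dual_order.strict_trans2 dual_order.trans not_less)
    then show ?thesis by blast
  qed
  finally show ?case .
qed (simp add: mu0_def)

text \<open>Column \<open>i\<close> of \<open>mu0\<close> has height \<open>Suc (i div k)\<close>,
  so \<open>i div k < j\<close> replaces the comparison with \<open>mu0\<close>; only columns still
  to be traversed occur.\<close>

definition boxes_left :: "nat \<Rightarrow> nat \<Rightarrow> nat \<Rightarrow> path \<Rightarrow> (nat \<times> nat) set" where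
  "boxes_left k x y w = {(i, j). i div k < j \<and> (\<exists>y'. (i, y') \<in> columns x y w \<and> j < y')}"

lemma columns_ge: "(i, y') \<in> columns x y w \<Longrightarrow> x \<le> i"
  by (auto simp: columns_eq)

lemma boxes_left_Down:
  "boxes_left k x y (Down # w) = Pair x ` {j. x div k < j \<and> j < y} \<union> boxes_left k (Suc x) y w"
  by (auto simp: boxes_left_def)

lemma finite_boxes_left: "finite (boxes_left k x y w)"
proof (induction x y w rule: columns.induct)
  case (3 x y w)
  then show ?case by (simp add: boxes_left_Down)
qed (simp_all add: boxes_left_def)

text \<open>The sum counts the boxes to the right of \<open>x\<close> in the rows the path has already climbed;
it converts the column count into the row count \<^const>\<open>area\<close>.\<close>

lemma card_boxes_left:
  assumes "0 < k" "w \<in> suffixes k n (k * y - x)" "x \<le> k * y"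
  shows "card (boxes_left k x y w) = area k (k * y - x) w + (\<Sum>j<y. k * j - x)"
  using assms(2,3)
proof (induction x y w arbitrary: n rule: columns.induct)
  case (1 x y)
  then have "x = k * y" by simp
  moreover have "(\<Sum>j<y. k * j - k * y) = 0" by (auto intro!: sum.neutral)
  ultimately show ?case by (simp add: boxes_left_def)
next
  case (2 x y w)
  have eq: "k * Suc y - x = k * y - x + k" using 2(3) by simp
  \<comment> \<open>The new summand, for \<open>j = y\<close>, is \<open>k * y - x\<close>: the very
    term that \<open>area\<close> gains at this up step.\<close>
  have "card (boxes_left k x (Suc y) w) = area k (k * Suc y - x) w + (\<Sum>j<Suc y. k * j - x)"
    by (rule 2(1)[of "n - 1"]) (use 2 eq in auto)
  then show ?case unfolding eq by (simp add: boxes_left_def)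
next
  case (3 x y w)
  have IH: "card (boxes_left k (Suc x) y w) = area k (k * y - Suc x) w + (\<Sum>j<y. k * j - Suc x)"
    by (rule 3(1)[of n]) (use 3 in auto)
  \<comment> \<open>Advancing \<open>x\<close> by one lowers the summand of row \<open>j\<close>
    exactly when the box of row \<open>j\<close> in column \<open>x\<close> lies above
    \<open>mu0\<close>.\<close>
  have "(\<Sum>j<y. k * j - x) = (\<Sum>j<y. (k * j - Suc x) + (if x div k < j then 1 else 0))"
  proof (intro sum.cong refl)
    fix j
    have "x div k < j \<longleftrightarrow> x < k * j"
      using assms(1) by (simp add: div_less_iff_less_mult mult.commute)
    then show "k * j - x = (k * j - Suc x) + (if x div k < j then 1 else 0)" by auto
  qed
  also have "\<dots> = (\<Sum>j<y. k * j - Suc x) + card {j. x div k < j \<and> j < y}"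
    by (simp add: sum.distrib sum.If_cases) (intro arg_cong[where f = card], auto)
  finally have sum: "(\<Sum>j<y. k * j - x) = \<dots>" .
  have "card (boxes_left k x y (Down # w)) =
      card {j. x div k < j \<and> j < y} + card (boxes_left k (Suc x) y w)"
    unfolding boxes_left_Down
    by (subst card_Un_disjoint)
       (auto simp: finite_boxes_left card_image inj_on_def, auto simp: boxes_left_def dest: columns_ge)
  with IH sum show ?case by simp
qed

lemma columns_less:
  "(i, y') \<in> columns x y w \<Longrightarrow> i < x + count_list w Down"
  by (induction x y w rule: columns.induct) auto

lemma card_boxes_between:
  assumes "0 < k" "w \<in> suffixes k n 0"
  shows "card (boxes_between (mu0 n k) w) = area k 0 w"
proof -
  \<comment> \<open>All columns of \<open>w\<close> lie to the left of \<open>k * n\<close>, hence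
    \<open>mu0\<close> has a down step over each of them.\<close>
  have "i < k * n" if "(i, y) \<in> columns 0 0 w" for i y
    using columns_less[OF that] assms(2) by (simp add: suffixes_def)
  then have "boxes_between (mu0 n k) w = boxes_left k 0 0 w"
    using columns_mu0[OF assms(1), of 0 n]
    by (auto simp: boxes_between_def box_above_iff box_below_iff boxes_left_def)
  then show ?thesis
    using card_boxes_left[OF assms(1), of w n 0 0] assms(2) by simp
qed

section \<open>Short valleys found by the scan\<close>

lemma valley_size_eq:
  assumes "z = pre @ replicate p Down @ Up # w" "pre = [] \<or> last pre = Up"
  shows "valley_size z (length pre + p) = p"
  unfolding valley_size_def
proof (rule Max_eqI)
  let ?S = "{q. \<exists>xs ys. z = xs @ replicate q Down @ [Up] @ ys \<and> length pre + p = length xs + q}"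
  show *: "q \<le> p" if q: "q \<in> ?S" for q
  proof (rule ccontr)
    assume "\<not> q \<le> p"
    obtain xs ys where xs: "z = xs @ replicate q Down @ [Up] @ ys" "length pre + p = length xs + q"
      using q by blast
    then have lt: "length xs < length pre" using \<open>\<not> q \<le> p\<close> by simp
    \<comment> \<open>A longer run before the same \<open>Up\<close> would cover the last position
      of \<open>pre\<close>.\<close>
    then have "z ! (length pre - 1) = Up"
      using assms last_conv_nth[of pre] by (cases "pre = []") (auto simp: nth_append)
    moreover have "z ! (length pre - 1) = Down"
      using lt xs \<open>\<not> q \<le> p\<close> by (auto simp: nth_append)
    ultimately show False by simp
  qed
  show "finite ?S" by (rule finite_subset[of _ "{..p}"]) (use * in auto)
  show "p \<in> ?S" using assms(1) by auto
qed

lemma valleys_iff: "v \<in> valleys w \<longleftrightarrow> 0 < v \<and> v < length w \<and> w ! (v - 1) = Down \<and> w ! v = Up"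
proof
  assume "v \<in> valleys w"
  then show "0 < v \<and> v < length w \<and> w ! (v - 1) = Down \<and> w ! v = Up"
    by (auto simp: valleys_def nth_append)
next
  assume v: "0 < v \<and> v < length w \<and> w ! (v - 1) = Down \<and> w ! v = Up"
  then have "w = take (v - 1) w @ [Down, Up] @ drop (Suc v) w"
    by (metis Cons_nth_drop_Suc Suc_pred' append_Cons append_Nil append_take_drop_id less_imp_diff_less)
  with v show "v \<in> valleys w" unfolding valleys_def
    by (intro CollectI exI[of _ "take (v - 1) w"] exI[of _ "drop (Suc v) w"]) auto
qed

text \<open>The whole path \<open>z\<close> stays fixed during the scan, because a valley size looks
  back at steps already read. These are split into \<open>pre\<close> and a maximal run of
  \<open>p\<close> down steps.\<close>

lemma card_small_valleys:
  assumes "z = pre @ replicate p Down @ w" "pre = [] \<or> last pre = Up"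
  shows "card {v \<in> valleys z. length pre + p \<le> v \<and> 0 < valley_size z v \<and> valley_size z v < k}
    = small_valleys k p w"
  using assms
proof (induction k p w arbitrary: pre rule: small_valleys.induct)
  case (1 k p)
  then show ?case by (auto simp: valleys_iff)
next
  case (2 k p w)
  let ?V = "\<lambda>l. {v \<in> valleys z. l \<le> v \<and> 0 < valley_size z v \<and> valley_size z v < k}"
  let ?l = "length pre + p"
  have size: "valley_size z ?l = p"
    using valley_size_eq 2(2,3) by blast
  have "?l \<in> valleys z" if "0 < p"
    using 2(2) that by (auto simp: valleys_iff nth_append)
  \<comment> \<open>For \<open>p = 0\<close> the index \<open>?l\<close> is discarded by the
    condition \<open>0 < valley_size z v\<close>.\<close>
  then have "?V ?l = (if 0 < p \<and> p < k then {?l} else {}) \<union> ?V (Suc ?l)"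
    using size by (auto simp: le_less Suc_le_eq)
  moreover have "finite (?V (Suc ?l))"
    by (rule finite_subset[of _ "{..length z}"]) (auto simp: valleys_iff)
  moreover have "card (?V (Suc ?l)) = small_valleys k 0 w"
    using 2(1)[of "pre @ replicate p Down @ [Up]"] 2(2) by simp
  ultimately show ?case by (auto simp: card_insert_if)
next
  case (3 k p w)
  have "length pre + p \<notin> valleys z"
    using 3(2) by (auto simp: valleys_iff nth_append)
  then have "{v \<in> valleys z. length pre + p \<le> v \<and> 0 < valley_size z v \<and> valley_size z v < k} =
      {v \<in> valleys z. length pre + Suc p \<le> v \<and> 0 < valley_size z v \<and> valley_size z v < k}"
    by (auto simp: le_less Suc_le_eq)
  then show ?case
    using 3(1)[of pre] 3(2,3) by (simp add: replicate_app_Cons_same)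
qed

lemma ValII_eq:
  assumes "0 < k"
  shows "ValII k w = small_valleys k 0 w"
proof -
  have "v \<le> k - 1 \<longleftrightarrow> v < k" for v using assms by auto
  then show ?thesis
    using card_small_valleys[of w "[]" 0 w k] by (simp add: ValII_def)
qed

section \<open>Weighted path sums and their recursion\<close>

definition up_weight :: "nat \<Rightarrow> nat \<Rightarrow> zmsu" where
  "up_weight k p = (if 0 < p \<and> p < k then m_var * u_var - m_var + 1 else m_var * u_var)"

fun path_weight :: "nat \<Rightarrow> nat \<Rightarrow> nat \<Rightarrow> path \<Rightarrow> zmsu" where
  "path_weight k h p [] = 1"
| "path_weight k h p (Up # w) = up_weight k p * s_var ^ h * path_weight k (h + k) 0 w"
| "path_weight k h p (Down # w) = path_weight k (h - 1) (Suc p) w"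

text \<open>Keeps the exponent in \<open>path_weight_eq\<close> free of truncation.\<close>

lemma small_valleys_le: "small_valleys k p w \<le> count_list w Up"
  by (induction k p w rule: small_valleys.induct) auto

lemma path_weight_eq:
  "path_weight k h p w = s_var ^ area k h w *
     ((m_var * u_var) ^ (count_list w Up - small_valleys k p w) *
      (m_var * u_var - m_var + 1) ^ small_valleys k p w)"
proof (induction k h p w rule: path_weight.induct)
  case (2 k h p w)
  then show ?case
    by (simp add: up_weight_def power_add Suc_diff_le small_valleys_le del: power_mult_distrib)
qed simp_all

lemma wtII_eq:
  assumes "0 < k"
  shows "wtII k n w = (m_var * u_var) ^ (n - small_valleys k 0 w) *
    (m_var * u_var - m_var + 1) ^ small_valleys k 0 w"
proof -
  \<comment> \<open>Identifies \<open>m' * u' + u' + 1\<close> with the short-valley value of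
    \<open>up_weight\<close>; its other value is \<open>(m' + 1) * (u' + 1)\<close>.\<close>
  have "(m_var - 1) * (u_var - 1) + (u_var - 1) + 1 = m_var * u_var - m_var + 1"
    by (simp add: algebra_simps)
  then show ?thesis
    by (simp add: wtII_def ValII_eq[OF assms] power_mult_distrib)
qed

definition path_sum :: "nat \<Rightarrow> nat \<Rightarrow> nat \<Rightarrow> nat \<Rightarrow> zmsu" where
  "path_sum k n h p = (\<Sum>w\<in>suffixes k n h. path_weight k h p w)"

lemma Dyck_sum_eq_path_sum:
  assumes "0 < k"
  shows "(\<Sum>w\<in>Dyck n k. s_var ^ card (boxes_between (mu0 n k) w) * wtII k n w) = path_sum k n 0 0"
  unfolding path_sum_def Dyck_eq_suffixes[OF assms]
proof (intro sum.cong refl)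
  fix w assume w: "w \<in> suffixes k n 0"
  then have "count_list w Up = n" by (simp add: suffixes_def)
  with w show "s_var ^ card (boxes_between (mu0 n k) w) * wtII k n w = path_weight k 0 0 w"
    by (simp add: card_boxes_between[OF assms] wtII_eq[OF assms] path_weight_eq)
qed

text \<open>Completions are split by their first step. An up step lowers \<open>n\<close>, a down
  step keeps \<open>n\<close> and lowers \<open>h\<close>, so the recursion determines all path
  sums.\<close>

lemma path_sum_rec:
  "path_sum k n h p = (if n = 0 \<and> h = 0 then 1 else 0) +
     (if 0 < n then up_weight k p * s_var ^ h * path_sum k (n - 1) (h + k) 0 else 0) +
     (if 0 < h then path_sum k n (h - 1) (Suc p) else 0)"
proof -
  let ?A = "if n = 0 \<and> h = 0 then {[]} else {} :: path set"
  let ?B = "if 0 < n then (#) Up ` suffixes k (n - 1) (h + k) else {}"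
  let ?C = "if 0 < h then (#) Down ` suffixes k n (h - 1) else {}"
  let ?W = "path_weight k h p"
  have "path_sum k n h p = sum ?W (?A \<union> ?B \<union> ?C)"
    by (simp add: path_sum_def suffixes_rec[of k n h])
  also have "\<dots> = sum ?W (?A \<union> ?B) + sum ?W ?C"
    by (rule sum.union_disjoint) (auto simp: finite_suffixes)
  also have "sum ?W (?A \<union> ?B) = sum ?W ?A + sum ?W ?B"
    by (rule sum.union_disjoint) (auto simp: finite_suffixes)
  finally show ?thesis
    by (auto simp: path_sum_def sum.reindex inj_on_def sum_distrib_left)
qed

section \<open>Rescaling of the series variable and products of shifts\<close>

lemma r_shift_nth: "r_shift j f $ n = s_var ^ (j * n) * f $ n"
proof -
  have "r_shift j f = f oo (fps_const (s_var ^ j) * fps_X)"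
    by (simp add: r_shift_def r_var_def mult.commute)
  then show ?thesis
    by (simp add: fps_compose_linear power_mult)
qed

lemma r_shift_0 [simp]: "r_shift 0 f = f"
  by (simp add: fps_eq_iff r_shift_nth)

lemma r_shift_r_shift: "r_shift i (r_shift j f) = r_shift (i + j) f"
  by (simp add: fps_eq_iff r_shift_nth power_add algebra_simps)

lemma r_shift_add: "r_shift j (f + g) = r_shift j f + r_shift j g"
  by (simp add: r_shift_def fps_compose_add_distrib)

lemma r_shift_diff: "r_shift j (f - g) = r_shift j f - r_shift j g"
  by (simp add: r_shift_def fps_compose_sub_distrib)

lemma r_shift_mult: "r_shift j (f * g) = r_shift j f * r_shift j g"
  by (simp add: r_shift_def r_var_def fps_compose_mult_distrib)

lemma r_shift_const [simp]: "r_shift j (fps_const c) = fps_const c"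
  by (simp add: r_shift_def)

lemma r_shift_1 [simp]: "r_shift j 1 = 1"
  by (simp add: r_shift_def)

lemma r_shift_X [simp]: "r_shift j fps_X = fps_X * fps_const (s_var ^ j)"
  by (simp add: r_shift_def r_var_def)

definition shift_prod :: "zmsu fps \<Rightarrow> nat \<Rightarrow> zmsu fps" where
  "shift_prod f h = (\<Prod>j<h. r_shift j f)"

lemma shift_prod_0 [simp]: "shift_prod f 0 = 1"
  by (simp add: shift_prod_def)

text \<open>Shifting by \<open>h\<close> moves the first \<open>i\<close> factors to the indices
  from \<open>h\<close> on; this absorbs the products of the shifted functional equation.\<close>

lemma shift_prod_add: "shift_prod f (h + i) = shift_prod f h * r_shift h (shift_prod f i)"
proof (induction i)
  case (Suc i)
  then show ?case
    by (simp add: shift_prod_def r_shift_mult r_shift_r_shift mult.assoc)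
qed simp

section \<open>From the functional equation to the path recursion\<close>

lemma functional_equation_iff:
  assumes "0 < k"
  shows "functional_equation k \<xi> \<longleftrightarrow>
    \<xi> = 1 + fps_X * (fps_const s_var * (fps_const (m_var - 1) * (shift_prod \<xi> k - \<xi>)
      - fps_const (m_var * u_var) * shift_prod \<xi> (Suc k)))"
proof -
  have "{0..k - 1} = {..<k}" "{0..k} = {..<Suc k}" using assms by auto
  then have *: "(\<Prod>j=0..k - 1. r_shift j \<xi>) = shift_prod \<xi> k"
    "(\<Prod>j=0..k. r_shift j \<xi>) = shift_prod \<xi> (Suc k)"
    by (simp_all only: shift_prod_def)
  have c: "fps_const (m_var * u_var) = fps_const m_var * fps_const u_var" by simp
  \<comment> \<open>The term with \<open>\<xi>\<close> and \<open>m_var - 1\<close> moves from left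
    to right, so that everything but the 1 carries a factor \<open>fps_X\<close>.\<close>
  show ?thesis
    unfolding functional_equation_def f_series_def * r_var_def c
    by (auto simp only: algebra_simps mult_1_left mult_1_right)
qed

text \<open>\<open>m u\<close> times the generating series of the state \<open>(h, p)\<close>. The terms with coefficient
\<open>m - 1\<close> are telescoped sums correcting the weight of the first up step where it ends a short
valley; the truncated subtractions are meant, since \<open>shift_prod \<xi> 0 = 1\<close> is the contribution of
the path that goes straight down to the line.\<close>

definition state_series :: "nat \<Rightarrow> zmsu fps \<Rightarrow> nat \<Rightarrow> nat \<Rightarrow> zmsu fps" where
  "state_series k \<xi> h p =
    (if p = 0 then fps_const (m_var * u_var) * shift_prod \<xi> (Suc h)
         - fps_const (m_var - 1) * (shift_prod \<xi> h - shift_prod \<xi> (Suc h - k))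
     else if p < k then fps_const (m_var * u_var - m_var + 1) * shift_prod \<xi> (Suc h)
         + fps_const (m_var - 1) * shift_prod \<xi> (Suc h - (k - p))
     else fps_const (m_var * u_var) * shift_prod \<xi> (Suc h))"

text \<open>The functional equation, shifted by \<open>h\<close> and multiplied by
  \<open>shift_prod \<xi> h\<close>. Up to \<open>up_weight\<close>, the right side is the
  contribution of an up step at height \<open>h\<close>, which leads to the state
  \<open>(h + k, 0)\<close>.\<close>

lemma shift_prod_Suc_diff:
  assumes "0 < k" "functional_equation k \<xi>"
  shows "shift_prod \<xi> (Suc h) - shift_prod \<xi> h =
    fps_X * (fps_const (- s_var) * (fps_const (s_var ^ h) * state_series k \<xi> (h + k) 0))"
proof -
  let ?R = "shift_prod \<xi>" and ?r = "r_shift h" and ?s = "fps_const (s_var ^ h)"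
  have eq: "?r \<xi> = 1 + fps_X * ?s * (fps_const s_var * (fps_const (m_var - 1) * (?r (?R k) - ?r \<xi>)
      - fps_const (m_var * u_var) * ?r (?R (Suc k))))"
    using arg_cong[OF assms(2)[unfolded functional_equation_iff[OF assms(1)]], of ?r]
    by (simp only: r_shift_add r_shift_mult r_shift_diff r_shift_const r_shift_1 r_shift_X)
  have 1: "?R (Suc h) = ?R h * ?r \<xi>"
    by (simp add: shift_prod_def)
  have "?R (Suc h) - ?R h = ?R h * (?r \<xi> - 1)"
    by (simp add: 1 algebra_simps)
  also have "?r \<xi> - 1 = fps_X * ?s * (fps_const s_var * (fps_const (m_var - 1) * (?r (?R k) - ?r \<xi>)
      - fps_const (m_var * u_var) * ?r (?R (Suc k))))"
    by (subst eq) simp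
  also have "?R h * \<dots> = fps_X * ?s * (fps_const s_var *
      (fps_const (m_var - 1) * (?R h * ?r (?R k) - ?R h * ?r \<xi>)
      - fps_const (m_var * u_var) * (?R h * ?r (?R (Suc k)))))"
    by (simp only: algebra_simps)
  also have "\<dots> = fps_X * ?s * (fps_const s_var *
      (fps_const (m_var - 1) * (?R (h + k) - ?R (Suc h))
      - fps_const (m_var * u_var) * ?R (Suc (h + k))))"
    using shift_prod_add[of \<xi> h k] shift_prod_add[of \<xi> h "Suc k"] 1 by simp
  \<comment> \<open>Here \<open>Suc (h + k) - k\<close> is \<open>Suc h\<close>, without
    truncation.\<close>
  also have "\<dots> = - (fps_X * ?s * (fps_const s_var * state_series k \<xi> (h + k) 0))"
    by (simp add: state_series_def algebra_simps del: fps_const_sub fps_const_mult fps_const_add)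
  also have "\<dots> = fps_X * (fps_const (- s_var) * (fps_const (s_var ^ h) * state_series k \<xi> (h + k) 0))"
    by (simp only: fps_const_neg[symmetric] mult_minus_left mult_minus_right mult_ac)
  finally show ?thesis .
qed

text \<open>A telescoping identity that holds for any series \<open>\<xi>\<close>. At
  \<open>h = 0\<close> the constant is the empty path, scaled by
  \<open>m_var * u_var\<close>.\<close>

lemma state_series_rec:
  assumes "2 \<le> k"
  shows "state_series k \<xi> h p = (if h = 0 then fps_const (m_var * u_var) else state_series k \<xi> (h - 1) (Suc p))
    + fps_const (up_weight k p) * (shift_prod \<xi> (Suc h) - shift_prod \<xi> h)"
proof -
  have b: "fps_const (m_var * u_var - m_var + 1) =
      fps_const (m_var * u_var) - fps_const (m_var - 1)"
    by (simp add: algebra_simps)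
  have up: "fps_const (up_weight k p) = (if 0 < p \<and> p < k
      then fps_const (m_var * u_var) - fps_const (m_var - 1) else fps_const (m_var * u_var))"
    by (simp only: up_weight_def b split: if_split) simp
  show ?thesis
  proof (cases h)
    case 0
    \<comment> \<open>Truncation turns the correcting products into
      \<open>shift_prod \<xi> 0 = 1\<close>.\<close>
    have "Suc 0 - k = 0" "p < k \<Longrightarrow> Suc 0 - (k - p) = 0" using assms by auto
    with 0 assms show ?thesis
      unfolding state_series_def up b by (simp add: ring_distribs del: fps_const_sub fps_const_mult fps_const_add)
  next
    case (Suc h')
    have "Suc p < k \<or> k = Suc p \<or> k \<le> p" by auto
    \<comment> \<open>A down step lowers both the height and the distance of the run to
      \<open>k\<close> by one, so the index of the correcting product is unchanged.\<close>
    moreover have "p = 0 \<Longrightarrow> Suc h' - (k - Suc p) = Suc h - k" "Suc p < k \<Longrightarrow> Suc h - (k - p) = Suc h' - (k - Suc p)"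
      using assms Suc by auto
    ultimately show ?thesis
      using assms Suc unfolding state_series_def up b
      by (auto simp: algebra_simps simp del: fps_const_sub fps_const_mult fps_const_add)
  qed
qed

text \<open>Both sides obey the same recursion. The outer induction leaves \<open>h\<close> free
  because an up step raises the height; the inner one on \<open>h\<close> handles down
  steps.\<close>

lemma state_series_nth:
  assumes "2 \<le> k" "functional_equation k \<xi>"
  shows "state_series k \<xi> h p $ n = m_var * u_var * ((- s_var) ^ n * path_sum k n h p)"
proof (induction n arbitrary: h p)
  case 0
  have step: "state_series k \<xi> h p $ 0 = (if h = 0 then m_var * u_var else state_series k \<xi> (h - 1) (Suc p) $ 0)" for h p
  proof -
    have "(shift_prod \<xi> (Suc h) - shift_prod \<xi> h) $ 0 = 0"
      using shift_prod_Suc_diff[of k \<xi> h] assms by simp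
    then show ?thesis
      by (subst state_series_rec[OF assms(1)]) simp
  qed
  show ?case
  proof (induction h arbitrary: p)
    case 0
    then show ?case by (simp add: step path_sum_rec[of k 0 0])
  next
    case (Suc h)
    then show ?case by (simp add: step[of "Suc h"] path_sum_rec[of k 0 "Suc h"])
  qed
next
  case (Suc n)
  note IH = Suc
  have step: "state_series k \<xi> h p $ Suc n = (if h = 0 then 0 else state_series k \<xi> (h - 1) (Suc p) $ Suc n)
      + m_var * u_var * ((- s_var) ^ Suc n * (up_weight k p * s_var ^ h * path_sum k n (h + k) 0))" for h p
  proof -
    have "(fps_const (up_weight k p) * (shift_prod \<xi> (Suc h) - shift_prod \<xi> h)) $ Suc n =
        up_weight k p * (- s_var * (s_var ^ h * state_series k \<xi> (h + k) 0 $ n))"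
      by (subst shift_prod_Suc_diff[of k]) (use assms in \<open>simp_all del: fps_const_neg\<close>)
    then show ?thesis
      by (subst state_series_rec[OF assms(1)]) (simp add: IH mult_ac)
  qed
  show ?case
  proof (induction h arbitrary: p)
    case 0
    then show ?case by (simp add: step path_sum_rec[of k "Suc n" 0])
  next
    case (Suc h)
    then show ?case
      by (simp only: step[of "Suc h"] path_sum_rec[of k "Suc n" "Suc h"]) (simp add: ring_distribs)
  qed
qed

lemma functional_equation_nth:
  assumes "2 \<le> k" "functional_equation k \<xi>"
  shows "\<xi> $ n = (- s_var) ^ n * path_sum k n 0 0"
proof -
  \<comment> \<open>Since \<open>Suc 0 - k = 0\<close>, the correction is a difference of equal
    products and vanishes.\<close>
  have "state_series k \<xi> 0 0 = fps_const (m_var * u_var) * \<xi>"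
    using assms(1) by (simp add: state_series_def shift_prod_def)
  then have "m_var * u_var * \<xi> $ n = m_var * u_var * ((- s_var) ^ n * path_sum k n 0 0)"
    using state_series_nth[OF assms, of 0 0 n] by simp
  moreover have "m_var * u_var \<noteq> 0"
    by (simp add: m_var_def u_var_def)
  ultimately show ?thesis by (metis mult_left_cancel)
qed

section \<open>Existence of a solution\<close>

lemma fps_fixed_point:
  fixes \<Psi> :: "'a::comm_ring_1 fps \<Rightarrow> 'a fps"
  assumes "\<And>n f g. (\<forall>i<n. f $ i = g $ i) \<Longrightarrow> (\<forall>i<n. \<Psi> f $ i = \<Psi> g $ i)"
  shows "\<exists>f. f = c + fps_X * \<Psi> f"
proof -
  define \<Phi> where "\<Phi> f = c + fps_X * \<Psi> f" for f
  \<comment> \<open>The factor \<open>fps_X\<close> gains one coefficient: \<open>\<Phi>\<close> is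
    a contraction in the \<open>fps_X\<close>-adic metric.\<close>
  have contr: "\<forall>i<Suc n. \<Phi> f $ i = \<Phi> g $ i" if "\<forall>i<n. f $ i = g $ i" for n f g
    using assms[OF that] by (auto simp: \<Phi>_def fps_X_mult_nth less_Suc_eq_0_disj)
  define F where "F n = (\<Phi> ^^ n) 0" for n
  have F_Suc: "F (Suc n) = \<Phi> (F n)" for n by (simp add: F_def)
  have step: "\<forall>i<n. F (Suc n) $ i = F n $ i" for n
    by (induction n) (use contr F_Suc in auto)
  have stable: "F (n + d) $ i = F n $ i" if "i < n" for n d i
    by (induction d) (use step that in auto)
  \<comment> \<open>Coefficient \<open>n\<close> is stable from the iterate \<open>Suc n\<close> on,
    so this is the limit of the iterates.\<close>
  define f where "f = Abs_fps (\<lambda>n. F (Suc n) $ n)"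
  have f: "\<forall>i<n. f $ i = F n $ i" for n
    using stable by (auto simp: f_def dest!: less_imp_Suc_add) (metis add_Suc lessI)
  have "f $ n = \<Phi> f $ n" for n
    using f[of "Suc n"] contr[OF f[of n]] F_Suc by simp
  then show ?thesis unfolding \<Phi>_def[symmetric] by (intro exI[of _ f] fps_ext)
qed

lemma fps_mult_cong_nth:
  fixes f g f' g' :: "'a::comm_ring_1 fps"
  assumes "\<forall>i<n. f $ i = f' $ i" "\<forall>i<n. g $ i = g' $ i"
  shows "\<forall>i<n. (f * g) $ i = (f' * g') $ i"
  using assms by (auto simp: fps_mult_nth intro!: sum.cong)

text \<open>Serves the hypothesis of \<open>fps_fixed_point\<close>: a shift rescales coefficients
  without moving them.\<close>

lemma shift_prod_cong_nth:
  assumes "\<forall>i<n. f $ i = g $ i"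
  shows "\<forall>i<n. shift_prod f h $ i = shift_prod g h $ i"
proof (induction h)
  case (Suc h)
  have "\<forall>i<n. r_shift h f $ i = r_shift h g $ i"
    using assms by (simp add: r_shift_nth)
  from fps_mult_cong_nth[OF Suc this] show ?case
    by (simp add: shift_prod_def)
qed simp

lemma functional_equation_solvable:
  assumes "0 < k"
  shows "\<exists>\<xi>. functional_equation k \<xi>"
  unfolding functional_equation_iff[OF assms]
proof (rule fps_fixed_point)
  fix n and f g :: "zmsu fps"
  assume "\<forall>i<n. f $ i = g $ i"
  then show "\<forall>i<n. (fps_const s_var * (fps_const (m_var - 1) * (shift_prod f k - f)
      - fps_const (m_var * u_var) * shift_prod f (Suc k))) $ i =
    (fps_const s_var * (fps_const (m_var - 1) * (shift_prod g k - g)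
      - fps_const (m_var * u_var) * shift_prod g (Suc k))) $ i"
    using shift_prod_cong_nth[of n f g] by simp
qed

theorem proposition4p25:
  fixes k :: nat
  assumes "k \<ge> 2"
  shows "(\<exists>!\<xi>. functional_equation k \<xi>) \<and>
         (\<forall>\<xi>. functional_equation k \<xi> \<longrightarrow>
            \<xi> = Abs_fps (\<lambda>n. (- s_var) ^ n * (\<Sum>\<mu>\<in>Dyck n k. s_var ^ card (boxes_between (mu0 n k) \<mu>) * wtII k n \<mu>)))"
proof -
  have "0 < k" using assms by simp
  \<comment> \<open>Every solution has this explicit form, which also gives uniqueness.\<close>
  have *: "\<xi> = Abs_fps (\<lambda>n. (- s_var) ^ n *
      (\<Sum>\<mu>\<in>Dyck n k. s_var ^ card (boxes_between (mu0 n k) \<mu>) * wtII k n \<mu>))"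
    if "functional_equation k \<xi>" for \<xi>
    using functional_equation_nth[OF assms that] Dyck_sum_eq_path_sum[OF \<open>0 < k\<close>]
    by (simp add: fps_eq_iff)
  moreover obtain \<xi> where "functional_equation k \<xi>"
    using functional_equation_solvable[OF \<open>0 < k\<close>] by blast
  ultimately show ?thesis by (metis (no_types, lifting))
qed

end
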